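(* Let $n\in\mathbb{N}$, $\mu\in\mathbb{R}$, $\sigma^2>0$, and let $\rho\in[-1,1]$ be such that the $n\times n$ matrix $\boldsymbol{\Sigma}$ with all diagonal entries equal to $\sigma^2$ and all off-diagonal entries equal to $\rho\sigma^2$ is a covariance matrix (positive semidefinite). Let $\boldsymbol{\mu}=(\mu,\ldots,\mu)^T\in\mathbb{R}^n$. Let $\mathbf{X}_n=(X_1,\ldots,X_n)^T$ have distribution ${\cal N}_n(\boldsymbol{\mu},\boldsymbol{\Sigma})$ and let $\mathbf{Y}_n=(Y_1,\ldots,Y_n)^T$ have distribution ${\cal N}_n(\boldsymbol{\mu},(1-\rho)\sigma^2\mathbf{I}_n)$. Let $\bar X_n=\frac1n\sum_{i=1}^nX_i$ and $\bar Y_n=\frac1n\sum_{i=1}^nY_i$. Then \[ {\cal L}(\mathbf{X}_n\mid\bar X_n)={\cal L}(\mathbf{Y}_n\mid\bar Y_n), \] and this conditional distribution does not depend on $\mu$. That is, there is a Markov kernel $\kappa$ from $\mathbb{R}$ to $\mathbb{R}^n$, not depending on $\mu$, such that $x\mapsto\kappa(x,\cdot)$ is both a version of the regular conditional distribution of $\mathbf{X}_n$ given $\bar X_n=x$ and a version of the regular conditional distribution of $\mathbf{Y}_n$ given $\bar Y_n=x$.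
   Context: ${\cal L}(\cdot)$ denotes the distribution (law) of a random vector, ${\cal L}(\cdot\mid\cdot)$ the conditional distribution, and $\mathbf{I}_n$ the $n\times n$ identity matrix. *)

theory Defs
  imports "HOL-Probability.Probability"
begin

text \<open>The variance \<open>v = 0\<close> is allowed and gives the point mass at \<open>m\<close>; note that
  \<^const>\<open>normal_density\<close> takes the standard deviation as its second argument.\<close>

definition normal_law :: "real \<Rightarrow> real \<Rightarrow> real measure" where
  "normal_law m v =
     (if v = 0 then return borel m else density lborel (\<lambda>x. ennreal (normal_density m (sqrt v) x)))"

definition positive_semidefinite :: "real ^ 'n ^ 'n \<Rightarrow> bool" where
  "positive_semidefinite S \<longleftrightarrow> transpose S = S \<and> (\<forall>v. 0 \<le> v \<bullet> (S *v v))"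

text \<open>The random vector \<open>X\<close> on \<open>M\<close> has the law \<open>N\<^sub>n(m, S)\<close>, where \<open>S\<close> may be singular: every linear
  combination of its coordinates is univariate normal, with the mean and the variance prescribed
  by \<open>m\<close> and \<open>S\<close>.\<close>

definition multivariate_normal ::
  "'a measure \<Rightarrow> ('a \<Rightarrow> real ^ 'n) \<Rightarrow> real ^ 'n \<Rightarrow> real ^ 'n ^ 'n \<Rightarrow> bool" where
  "multivariate_normal M X m S \<longleftrightarrow>
     X \<in> borel_measurable M \<and> positive_semidefinite S \<and>
     (\<forall>t. distr M borel (\<lambda>\<omega>. t \<bullet> X \<omega>) = normal_law (t \<bullet> m) (t \<bullet> (S *v t)))"

definition exchangeable_cov :: "real \<Rightarrow> real \<Rightarrow> real ^ 'n ^ 'n" where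
  "exchangeable_cov v r = (\<chi> i j. if i = j then v else r * v)"

definition sample_mean :: "real ^ 'n \<Rightarrow> real" where
  "sample_mean x = (\<Sum>i\<in>UNIV. x $ i) / real CARD('n)"

text \<open>\<open>\<kappa>\<close> is a version of the regular conditional distribution of \<open>X\<close> given \<open>T\<close>: a Markov kernel
  such that, for every Borel set \<open>B\<close>, the random variable \<open>\<kappa>(T, B)\<close> is a version of the conditional
  probability of \<open>X \<in> B\<close> given the sigma-algebra generated by \<open>T\<close>.\<close>

definition regular_conditional_distribution ::
  "'a measure \<Rightarrow> ('a \<Rightarrow> 'b::topological_space) \<Rightarrow> ('a \<Rightarrow> 'c::topological_space) \<Rightarrow>
   ('c \<Rightarrow> 'b measure) \<Rightarrow> bool" where
  "regular_conditional_distribution M X T \<kappa> \<longleftrightarrow>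
     X \<in> borel_measurable M \<and> T \<in> borel_measurable M \<and>
     \<kappa> \<in> borel \<rightarrow>\<^sub>M prob_algebra borel \<and>
     (\<forall>B\<in>sets borel. AE \<omega> in M.
        real_cond_exp M (vimage_algebra (space M) T borel) (indicator (X -` B \<inter> space M)) \<omega>
          = measure (\<kappa> (T \<omega>)) B)"

end

theory Submission
  imports Defs
begin

text \<open>The covariance matrices of both vectors have the form \<open>c I + d J\<close> with \<open>J\<close> the all-ones matrix and
  the same \<open>c = (1 - \<rho>) \<sigma>\<^sup>2\<close>. Hence the characteristic function at \<open>t\<close> is \<open>exp (- c \<bar>t\<bar>\<^sup>2 / 2)\<close> times a
  function of \<open>\<Sum>\<^sub>i t\<^sub>i\<close> alone, and \<open>\<mu>\<close> and \<open>d\<close> enter through the second factor only. It follows that the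
  joint characteristic function of the residual \<open>X - m 1\<close> and the sample mean \<open>m\<close> factorizes: the two are
  independent, and the law of the residual depends only on \<open>c\<close>. The conditional distribution given
  \<open>m = x\<close> is therefore this common residual law translated by \<open>x 1\<close>.\<close>

section \<open>Finite measures on the line and their Fourier transforms\<close>

lemma borel_measurable_cis [measurable]: "cis \<in> borel_measurable borel"
  by (intro borel_measurable_continuous_onI continuous_intros)

lemma (in finite_measure) integrable_cis:
  assumes [measurable]: "f \<in> borel_measurable M"
  shows "integrable M (\<lambda>x. cis (f x))"
  by (rule integrable_const_bound[where B=1]) auto

lemma (in finite_measure) integrable_bounded_cis:
  assumes [measurable]: "f \<in> borel_measurable M" "w \<in> borel_measurable M"
    and "\<And>x. \<bar>w x\<bar> \<le> B"
  shows "integrable M (\<lambda>x. w x *\<^sub>R cis (f x))"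
  by (rule integrable_const_bound[where B=B]) (auto simp: assms)

text \<open>Levy's uniqueness theorem concerns probability measures. The transform at 0 gives the
  common total mass \<open>m\<close>; dividing by \<open>m\<close> reduces to that theorem, and mass
  zero is treated apart.\<close>

lemma finite_borel_measure_eqI_cis:
  fixes M N :: "real measure"
  assumes "finite_measure M" "finite_measure N"
    and sets_M [measurable_cong]: "sets M = sets borel"
    and sets_N [measurable_cong]: "sets N = sets borel"
    and eq: "\<And>t. (LINT x|M. cis (t * x)) = (LINT x|N. cis (t * x))"
  shows "M = N"
proof -
  interpret M: finite_measure M by fact
  interpret N: finite_measure N by fact
  have space: "space M = UNIV" "space N = UNIV"
    using sets_eq_imp_space_eq[OF sets_M] sets_eq_imp_space_eq[OF sets_N] by auto
  define m where "m = measure M UNIV"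
  have "m = measure N UNIV"
    using eq[of 0] by (simp add: m_def space scaleR_conv_of_real)
  then have mM: "emeasure M UNIV = ennreal m" and mN: "emeasure N UNIV = ennreal m"
    by (simp_all add: m_def M.emeasure_eq_measure N.emeasure_eq_measure)
  show ?thesis
  proof (cases "m = 0")
    case True
    then have "emeasure M A = 0" "emeasure N A = 0" for A
      using mM mN emeasure_space[of M A] emeasure_space[of N A] by (simp_all add: space)
    then show ?thesis
      by (intro measure_eqI) (simp_all add: sets_M sets_N)
  next
    case False
    then have pos: "m > 0"
      by (simp add: m_def zero_less_measure_iff)
    define D :: "real measure \<Rightarrow> real measure" where "D K = density K (\<lambda>_. ennreal (1 / m))" for K
    have D_M: "emeasure (D M) A = ennreal (1 / m) * emeasure M A" if "A \<in> sets borel" for A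
      using that by (simp add: D_def emeasure_density_const sets_M)
    have D_N: "emeasure (D N) A = ennreal (1 / m) * emeasure N A" if "A \<in> sets borel" for A
      using that by (simp add: D_def emeasure_density_const sets_N)
    have one: "ennreal (1 / m) * ennreal m = 1"
      using pos by (simp flip: ennreal_mult)
    have "real_distribution (D M)"
      using D_M[of UNIV] one
      by (auto simp: real_distribution_def real_distribution_axioms_def D_def sets_M space mM
          intro!: prob_spaceI)
    moreover have "real_distribution (D N)"
      using D_N[of UNIV] one
      by (auto simp: real_distribution_def real_distribution_axioms_def D_def sets_N space mN
          intro!: prob_spaceI)
    moreover have "char (D M) = char (D N)"
      using pos eq by (simp add: fun_eq_iff char_def D_def integral_density cis_conv_exp)
    ultimately have "D M = D N"
      by (rule Levy_uniqueness)
    have "emeasure M A = emeasure N A" if A: "A \<in> sets borel" for A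
    proof -
      have "ennreal (1 / m) * emeasure M A = ennreal (1 / m) * emeasure N A"
        using D_M[OF A] D_N[OF A] \<open>D M = D N\<close> by simp
      then show ?thesis
        using pos by (simp add: ennreal_mult_cancel_left)
    qed
    then show ?thesis
      by (intro measure_eqI) (simp_all add: sets_M sets_N)
  qed
qed

section \<open>Uniqueness of Fourier transforms in Euclidean space\<close>

text \<open>The hypothesis \<open>eq\<close> compares the Fourier transforms of the images under
  \<open>f\<close> of the two measures with density \<open>w\<close>. The bounds on \<open>w\<close>
  make these images finite measures on the line, so they coincide.\<close>

lemma weighted_marginal_eq:
  fixes M N :: "'a measure" and w f :: "'a \<Rightarrow> real"
  assumes "finite_measure M" "finite_measure N" and sets: "sets N = sets M"
    and [measurable]: "f \<in> borel_measurable M" "w \<in> borel_measurable M" "B \<in> sets borel"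
    and w: "\<And>x. 0 \<le> w x" "\<And>x. w x \<le> b"
    and eq: "\<And>s. (LINT x|M. w x *\<^sub>R cis (s * f x)) = (LINT x|N. w x *\<^sub>R cis (s * f x))"
  shows "(LINT x|M. w x * indicator B (f x)) = (LINT x|N. w x * indicator B (f x))"
proof -
  have D: "finite_measure (distr (density K w) borel f) \<and>
      (\<forall>s. (LINT x|distr (density K w) borel f. cis (s * x)) = (LINT x|K. w x *\<^sub>R cis (s * f x))) \<and>
      (LINT x|distr (density K w) borel f. indicat_real B x) = (LINT x|K. w x * indicator B (f x))"
    if "finite_measure K" and [measurable_cong]: "sets K = sets M" for K
  proof -
    interpret K: finite_measure K by fact
    have "integrable K w"
      using w by (intro K.integrable_const_bound[where B=b]) auto
    then have "(\<integral>\<^sup>+x. w x \<partial>K) \<noteq> \<infinity>"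
      using w by (simp add: nn_integral_eq_integral)
    moreover have "emeasure (density K w) (space K) = (\<integral>\<^sup>+x. w x \<partial>K)"
      by (auto simp: emeasure_density intro!: nn_integral_cong)
    ultimately have "finite_measure (density K w)"
      by (intro finite_measureI) simp
    then have "finite_measure (distr (density K w) borel f)"
      by (intro finite_measure.finite_measure_distr) auto
    moreover have "(LINT x|distr (density K w) borel f. indicat_real B x) =
        (LINT x|K. w x * indicator B (f x))"
      using w by (subst integral_distr; simp add: integral_density)
    ultimately show ?thesis
      using w by (simp add: integral_distr integral_density)
  qed
  have "distr (density M w) borel f = distr (density N w) borel f"
    using D[of M] D[of N] assms(1,2) sets eq by (intro finite_borel_measure_eqI_cis) auto
  with D[of M] D[of N] assms(1,2) sets show ?thesis by metis
qed

text \<open>The weights \<open>1 + cos (t \<bullet> x)\<close> and \<open>1 + sin (t \<bullet> x)\<close> are nonnegative, so the uniqueness theorem on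
  the line applies to the correspondingly weighted marginals; subtracting the weight \<open>1\<close> recovers
  the real and imaginary parts of \<open>cis (t \<bullet> x)\<close>.\<close>

lemma cis_integral_eq_Int_vimage:
  fixes M N :: "'a::euclidean_space measure"
  assumes "finite_measure M" "finite_measure N"
    and sets_M [measurable_cong]: "sets M = sets borel"
    and sets_N [measurable_cong]: "sets N = sets borel"
    and [measurable]: "E \<in> sets borel" "B \<in> sets borel"
    and eq: "\<And>t. (LINT x|M. indicator E x *\<^sub>R cis (t \<bullet> x)) = (LINT x|N. indicator E x *\<^sub>R cis (t \<bullet> x))"
  shows "(LINT x|M. indicator (E \<inter> {x. b \<bullet> x \<in> B}) x *\<^sub>R cis (t \<bullet> x)) =
    (LINT x|N. indicator (E \<inter> {x. b \<bullet> x \<in> B}) x *\<^sub>R cis (t \<bullet> x))"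
proof -
  interpret M: finite_measure M by fact
  interpret N: finite_measure N by fact
  let ?F = "E \<inter> {x. b \<bullet> x \<in> B}"
  have F [measurable]: "?F \<in> sets borel" by measurable
  have ind: "indicat_real E x * indicator B (b \<bullet> x) = indicator ?F x" for x
    by (simp add: indicator_def)
  have int_cis [simp]: "integrable M (\<lambda>x. indicator A x *\<^sub>R cis (t \<bullet> x))"
      "integrable N (\<lambda>x. indicator A x *\<^sub>R cis (t \<bullet> x))" if [measurable]: "A \<in> sets borel" for t A
    by (rule M.integrable_bounded_cis[where B=1] N.integrable_bounded_cis[where B=1];
        simp add: indicator_def)+
  have int_real [simp]: "integrable M (\<lambda>x. indicat_real A x * h x)" "integrable N (\<lambda>x. indicat_real A x * h x)"
    if [measurable]: "A \<in> sets borel" "h \<in> borel_measurable borel" and "\<And>x. \<bar>h x\<bar> \<le> 1" for A h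
    by (rule M.integrable_const_bound[where B=1] N.integrable_const_bound[where B=1];
        simp add: indicator_def that)+
  define e where "e u x = indicat_real E x *\<^sub>R cis (u \<bullet> x)" for u x
  have e [simp]: "integrable M (e u)" "integrable N (e u)" "integral\<^sup>L M (e u) = integral\<^sup>L N (e u)" for u
    using eq[of u] by (simp_all add: e_def[abs_def])
  \<comment> \<open>Writing cosine and sine as combinations of exponentials turns the weight into
    frequency shifts by \<open>t\<close> and \<open>- t\<close>, so the weighted transform combines
    values of \<open>e\<close> whose integrals are already known to agree. The factors
    \<open>- \<i> / 2\<close> and \<open>\<i> / 2\<close> below come from 1/(2i).\<close>
  have cos_eq: "(indicat_real E x * (1 + cos (t \<bullet> x))) *\<^sub>R cis (s * (b \<bullet> x)) =
      e (s *\<^sub>R b) x + (1/2) *\<^sub>R e (s *\<^sub>R b + t) x + (1/2) *\<^sub>R e (s *\<^sub>R b - t) x" for s x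
    by (auto simp: e_def complex_eq_iff inner_left_distrib inner_diff_left cos_add cos_diff sin_add
        sin_diff indicator_def algebra_simps diff_divide_distrib add_divide_distrib)
  have sin_eq: "(indicat_real E x * (1 + sin (t \<bullet> x))) *\<^sub>R cis (s * (b \<bullet> x)) =
      e (s *\<^sub>R b) x + (- \<i> / 2) * e (s *\<^sub>R b + t) x + (\<i> / 2) * e (s *\<^sub>R b - t) x" for s x
    by (auto simp: e_def complex_eq_iff inner_left_distrib inner_diff_left cos_add cos_diff sin_add
        sin_diff indicator_def algebra_simps diff_divide_distrib add_divide_distrib)
  have one: "(LINT x|M. indicat_real ?F x) = (LINT x|N. indicat_real ?F x)"
    using weighted_marginal_eq[OF assms(1,2), of "\<lambda>x. b \<bullet> x" "indicator E" B 1] eq[of "_ *\<^sub>R b"]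
    by (simp add: ind sets_M sets_N indicator_le_1)
  have transfer: "(LINT x|M. indicat_real ?F x * h x) = (LINT x|N. indicat_real ?F x * h x)"
    if [measurable]: "h \<in> borel_measurable borel" and h: "\<And>x. \<bar>h x\<bar> \<le> 1"
      and eq_h: "\<And>s. (LINT x|M. (indicat_real E x * (1 + h x)) *\<^sub>R cis (s * (b \<bullet> x))) =
        (LINT x|N. (indicat_real E x * (1 + h x)) *\<^sub>R cis (s * (b \<bullet> x)))" for h
  proof -
    have h': "0 \<le> 1 + h x" "1 + h x \<le> 2" for x
      using h[of x] by auto
    have "(LINT x|M. indicat_real E x * (1 + h x) * indicator B (b \<bullet> x)) =
        (LINT x|N. indicat_real E x * (1 + h x) * indicator B (b \<bullet> x))"
    proof (rule weighted_marginal_eq[OF assms(1,2), where b=2])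
      show "0 \<le> indicat_real E x * (1 + h x)" "indicat_real E x * (1 + h x) \<le> 2" for x
        using h'[of x] by (simp_all add: indicator_def)
    qed (simp_all add: sets_M sets_N eq_h)
    moreover have "indicat_real E x * (1 + h x) * indicator B (b \<bullet> x) =
        indicator ?F x + indicator ?F x * h x" for x
      by (simp add: indicator_def)
    ultimately show ?thesis
      using one int_real[OF F, of h] int_real[OF F, of "\<lambda>_. 1"] h by simp
  qed
  have cos: "(LINT x|M. indicat_real ?F x * cos (t \<bullet> x)) = (LINT x|N. indicat_real ?F x * cos (t \<bullet> x))"
    by (rule transfer) (simp_all add: cos_eq)
  have sin: "(LINT x|M. indicat_real ?F x * sin (t \<bullet> x)) = (LINT x|N. indicat_real ?F x * sin (t \<bullet> x))"
    by (rule transfer) (simp_all add: sin_eq)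
  show ?thesis
    using cos sin int_cis[OF F, of t]
    by (simp add: complex_eq_iff flip: integral_Re integral_Im)
qed

text \<open>Coordinates are localized one at a time: after restriction to a cylinder the transforms
  still agree, so another coordinate can be restricted. Once all are restricted, the measures agree
  on open boxes, an intersection-stable generator of the Borel sets.\<close>

lemma finite_borel_measure_eqI_cis_euclidean:
  fixes M N :: "'a::euclidean_space measure"
  assumes "finite_measure M" "finite_measure N"
    and sets_M: "sets M = sets borel" and sets_N: "sets N = sets borel"
    and eq: "\<And>t. (LINT x|M. cis (t \<bullet> x)) = (LINT x|N. cis (t \<bullet> x))"
  shows "M = N"
proof -
  interpret M: finite_measure M by fact
  interpret N: finite_measure N by fact
  \<comment> \<open>The claim is kept for all frequencies \<open>t\<close>, since restricting a
    further coordinate uses the induction hypothesis at shifted frequencies.\<close>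
  have cyl: "{x::'a. \<forall>b\<in>A. b \<bullet> x \<in> I b} \<in> sets borel \<and>
      (\<forall>t. (LINT x|M. indicator {x. \<forall>b\<in>A. b \<bullet> x \<in> I b} x *\<^sub>R cis (t \<bullet> x)) =
        (LINT x|N. indicator {x. \<forall>b\<in>A. b \<bullet> x \<in> I b} x *\<^sub>R cis (t \<bullet> x)))"
    if "finite A" and [measurable]: "\<And>b. I b \<in> sets borel" for A :: "'a set" and I :: "'a \<Rightarrow> real set"
    using that(1)
  proof (induction A)
    case (insert c A)
    have split: "{x. \<forall>b\<in>insert c A. b \<bullet> x \<in> I b} =
        {x. \<forall>b\<in>A. b \<bullet> x \<in> I b} \<inter> {x. c \<bullet> x \<in> I c}"
      by auto
    have "{x. c \<bullet> x \<in> I c} \<in> sets borel"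
      by measurable
    then show ?case
      unfolding split using insert.IH
      by (auto intro!: cis_integral_eq_Int_vimage[OF assms(1,2) sets_M sets_N])
  qed (simp add: eq)
  have space: "space M = UNIV" "space N = UNIV"
    using sets_eq_imp_space_eq[OF sets_M] sets_eq_imp_space_eq[OF sets_N] by auto
  have box: "emeasure M (box a b) = emeasure N (box a b)" for a b
  proof -
    have eq_box: "{x. \<forall>i\<in>Basis. i \<bullet> x \<in> {a \<bullet> i<..<b \<bullet> i}} = box a b"
      by (auto simp: box_def inner_commute)
    have "\<forall>t. (LINT x|M. indicator (box a b) x *\<^sub>R cis (t \<bullet> x)) =
        (LINT x|N. indicator (box a b) x *\<^sub>R cis (t \<bullet> x))"
      using cyl[of Basis "\<lambda>i. {a \<bullet> i<..<b \<bullet> i}"] unfolding eq_box by simp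
    \<comment> \<open>At frequency 0 the restricted transform is just the measure of the
      box.\<close>
    then have "(LINT x|M. indicator (box a b) x *\<^sub>R cis (0 \<bullet> x)) =
        (LINT x|N. indicator (box a b) x *\<^sub>R cis (0 \<bullet> x))"
      by (rule spec)
    then have "complex_of_real (measure M (box a b)) = complex_of_real (measure N (box a b))"
      by (simp add: scaleR_conv_of_real space sets_M sets_N M.emeasure_eq_measure N.emeasure_eq_measure)
    then show ?thesis
      by (simp add: M.emeasure_eq_measure N.emeasure_eq_measure)
  qed
  show ?thesis
  proof (rule measure_eqI_generator_eq)
    let ?E = "range (\<lambda>(a, b). box a b :: 'a set)"
    show "Int_stable ?E"
      by (auto simp: Int_stable_def box_Int_box)
    show "?E \<subseteq> Pow UNIV" "sets M = sigma_sets UNIV ?E" "sets N = sigma_sets UNIV ?E"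
      by (simp_all add: borel_eq_box sets_M sets_N)
    let ?A = "\<lambda>n::nat. box (- (real n *\<^sub>R One)) (real n *\<^sub>R One) :: 'a set"
    show "range ?A \<subseteq> ?E" "(\<Union>i. ?A i) = UNIV"
      unfolding UN_box_eq_UNIV by auto
    show "emeasure M (?A i) \<noteq> \<infinity>" for i
      by simp
    show "emeasure M X = emeasure N X" if "X \<in> ?E" for X
      using that box by auto
  qed
qed

section \<open>Independence from factorizing transforms\<close>

text \<open>Kac's criterion: by Fubini the product measure has the product of the marginal
  transforms as its transform, so uniqueness on the product space applies.\<close>

lemma distr_Pair_eqI_cis:
  fixes U :: "'c \<Rightarrow> 'a::euclidean_space" and V :: "'c \<Rightarrow> 'b::euclidean_space"
  assumes "prob_space M" and [measurable]: "U \<in> borel_measurable M" "V \<in> borel_measurable M"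
    and eq: "\<And>s t. (LINT \<omega>|M. cis (s \<bullet> U \<omega> + t \<bullet> V \<omega>)) =
      (LINT \<omega>|M. cis (s \<bullet> U \<omega>)) * (LINT \<omega>|M. cis (t \<bullet> V \<omega>))"
  shows "distr M borel (\<lambda>\<omega>. (U \<omega>, V \<omega>)) = distr M borel U \<Otimes>\<^sub>M distr M borel V"
proof -
  interpret prob_space M by fact
  interpret U: prob_space "distr M borel U" by (rule prob_space_distr) simp
  interpret V: prob_space "distr M borel V" by (rule prob_space_distr) simp
  interpret UV: pair_prob_space "distr M borel U" "distr M borel V" ..
  show ?thesis
  proof (rule finite_borel_measure_eqI_cis_euclidean)
    show "finite_measure (distr M borel (\<lambda>\<omega>. (U \<omega>, V \<omega>)))"
      by (intro finite_measure_distr) simp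
    show "finite_measure (distr M borel U \<Otimes>\<^sub>M distr M borel V)"
      by (rule UV.P.finite_measure_axioms)
    show "sets (distr M borel U \<Otimes>\<^sub>M distr M borel V) = sets borel"
      by (subst borel_prod[symmetric]) (intro sets_pair_measure_cong; simp)
  next
    fix t :: "'a \<times> 'b"
    have joint: "(LINT x|distr M borel (\<lambda>\<omega>. (U \<omega>, V \<omega>)). cis (t \<bullet> x)) =
        (LINT \<omega>|M. cis (fst t \<bullet> U \<omega> + snd t \<bullet> V \<omega>))"
      by (subst integral_distr) (simp_all add: inner_prod_def[of _ "(_, _)"])
    have "(LINT x|(distr M borel U \<Otimes>\<^sub>M distr M borel V). cis (t \<bullet> x)) =
        (LINT u|distr M borel U. LINT v|distr M borel V. cis (t \<bullet> (u, v)))"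
      by (subst UV.integral_fst'[symmetric]; (intro UV.P.integrable_cis)?)
         (simp_all add: case_prod_beta' inner_prod_def)
    also have "\<dots> = (LINT u|distr M borel U. cis (fst t \<bullet> u)) * (LINT v|distr M borel V. cis (snd t \<bullet> v))"
      by (simp add: inner_prod_def flip: cis_mult)
    also have "\<dots> = (LINT x|distr M borel (\<lambda>\<omega>. (U \<omega>, V \<omega>)). cis (t \<bullet> x))"
      by (simp add: joint integral_distr eq)
    finally show "(LINT x|distr M borel (\<lambda>\<omega>. (U \<omega>, V \<omega>)). cis (t \<bullet> x)) =
        (LINT x|(distr M borel U \<Otimes>\<^sub>M distr M borel V). cis (t \<bullet> x))" ..
  qed simp
qed

section \<open>Characteristic functions of normal laws\<close>

lemma char_normal_law:
  assumes "0 \<le> v"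
  shows "char (normal_law m v) t = cis (m * t) * exp (- (v * t\<^sup>2) / 2)"
proof (cases "v = 0")
  case True
  then show ?thesis
    by (simp add: normal_law_def char_def integral_return cis_conv_exp mult.commute)
next
  case False
  then have v: "0 < sqrt v"
    using assms by simp
  interpret real_distribution std_normal_distribution
    by (rule real_dist_normal_dist)
  have "distributed std_normal_distribution lborel (\<lambda>x. x) std_normal_density"
    by (simp add: distributed_def distr_id2)
  \<comment> \<open>For positive variance the law is an affine image of the standard normal law,
    whose characteristic function is known.\<close>
  then have "distributed std_normal_distribution lborel (\<lambda>x. m + sqrt v * x) (normal_density m (sqrt v))"
    using normal_density_affine[of "\<lambda>x. x" 0 1 "sqrt v" m] v by simp
  then have "normal_law m v = distr std_normal_distribution borel (\<lambda>x. m + sqrt v * x)"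
    using False by (simp add: normal_law_def distributed_def cong: distr_cong)
  then have "char (normal_law m v) t = (LINT x|std_normal_distribution. iexp (t * (m + sqrt v * x)))"
    by (simp add: char_def integral_distr)
  also have "\<dots> = (LINT x|std_normal_distribution. cis (m * t) * iexp (t * sqrt v * x))"
    by (simp add: cis_conv_exp algebra_simps flip: exp_add)
  also have "\<dots> = cis (m * t) * char std_normal_distribution (t * sqrt v)"
    by (simp add: char_def)
  also have "\<dots> = cis (m * t) * exp (- (v * t\<^sup>2) / 2)"
    using assms by (simp add: char_std_normal_distribution power_mult_distrib mult.commute)
  finally show ?thesis .
qed

text \<open>The transform of \<open>X\<close> at \<open>t\<close> is the univariate characteristic
  function of \<open>t \<bullet> X\<close> at 1, and that law is prescribed by the
  definition.\<close>

lemma multivariate_normal_integral_cis: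
  assumes "multivariate_normal M X m S"
  shows "(LINT \<omega>|M. cis (t \<bullet> X \<omega>)) = cis (t \<bullet> m) * exp (- (t \<bullet> (S *v t)) / 2)"
proof -
  have [measurable]: "X \<in> borel_measurable M" and "0 \<le> t \<bullet> (S *v t)"
    and distr: "distr M borel (\<lambda>\<omega>. t \<bullet> X \<omega>) = normal_law (t \<bullet> m) (t \<bullet> (S *v t))"
    using assms by (auto simp: multivariate_normal_def positive_semidefinite_def)
  have "(LINT \<omega>|M. cis (t \<bullet> X \<omega>)) = char (distr M borel (\<lambda>\<omega>. t \<bullet> X \<omega>)) 1"
    by (simp add: char_def integral_distr cis_conv_exp)
  also have "\<dots> = cis (t \<bullet> m) * exp (- (t \<bullet> (S *v t)) / 2)"
    using \<open>0 \<le> t \<bullet> (S *v t)\<close> by (simp add: distr char_normal_law)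
  finally show ?thesis .
qed

section \<open>Conditional distributions of translates\<close>

lemma measurable_distr_shift:
  fixes h :: "'c::second_countable_topology \<Rightarrow> 'b::{second_countable_topology, real_normed_vector}"
  assumes "prob_space R" and [measurable_cong]: "sets R = sets borel"
    and [measurable]: "h \<in> borel_measurable borel"
  shows "(\<lambda>t. distr R borel (\<lambda>r. r + h t)) \<in> borel \<rightarrow>\<^sub>M prob_algebra borel"
  by (rule measurable_distr_prob_space2[where M=borel])
     (use assms in \<open>simp_all add: space_prob_algebra\<close>)

lemma regular_conditional_distribution_shift:
  fixes X :: "'a \<Rightarrow> 'b::{second_countable_topology, real_normed_vector}"
    and T :: "'a \<Rightarrow> 'c::second_countable_topology"
  assumes "prob_space M" "prob_space R" and sets_R [measurable_cong]: "sets R = sets borel"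
    and [measurable]: "X \<in> borel_measurable M" "T \<in> borel_measurable M" "h \<in> borel_measurable borel"
    and distr: "distr M borel (\<lambda>\<omega>. (X \<omega> - h (T \<omega>), T \<omega>)) = R \<Otimes>\<^sub>M distr M borel T"
  shows "regular_conditional_distribution M X T (\<lambda>t. distr R borel (\<lambda>r. r + h t))"
  unfolding regular_conditional_distribution_def
proof (intro conjI ballI)
  interpret prob_space M by fact
  interpret R: prob_space R by fact
  interpret T: prob_space "distr M borel T" by (rule prob_space_distr) simp
  interpret RT: pair_prob_space R "distr M borel T" ..
  show kernel: "(\<lambda>t. distr R borel (\<lambda>r. r + h t)) \<in> borel \<rightarrow>\<^sub>M prob_algebra borel"
    by (rule measurable_distr_shift) fact+
  let ?F = "vimage_algebra (space M) T borel"
  have sub: "subalgebra M ?F"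
    using sets_image_in_sets[of M "space M" T borel] by (simp add: subalgebra_def)
  then interpret finite_measure_subalgebra M ?F
    by unfold_locales
  fix B :: "'b set" assume [measurable]: "B \<in> sets borel"
  let ?k = "\<lambda>t. measure (distr R borel (\<lambda>r. r + h t)) B"
  have [measurable]: "?k \<in> borel_measurable borel"
    using measurable_compose[OF kernel measurable_measure_prob_algebra] by simp
  have T_F [measurable]: "T \<in> ?F \<rightarrow>\<^sub>M borel"
    by (rule measurable_vimage_algebra1) simp
  \<comment> \<open>This form of the kernel is the inner integral that Fubini produces
    below.\<close>
  have k: "?k t = (LINT r|R. indicator B (r + h t))" for t
  proof -
    have "?k t = (LINT x|distr R borel (\<lambda>r. r + h t). indicator B x)"
      by simp
    also have "\<dots> = (LINT r|R. indicator B (r + h t))"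
      by (rule integral_distr) simp_all
    finally show ?thesis .
  qed
  show "AE \<omega> in M. real_cond_exp M ?F (indicator (X -` B \<inter> space M)) \<omega> = ?k (T \<omega>)"
  proof (rule real_cond_exp_charact)
    fix A assume "A \<in> sets ?F"
    then obtain C where [measurable]: "C \<in> sets borel" and A: "A = T -` C \<inter> space M"
      by (auto simp: sets_vimage_algebra2)
    \<comment> \<open>The event that \<open>X\<close> lies in \<open>B\<close> and \<open>T\<close>
      in \<open>C\<close>, expressed through the residual \<open>r\<close> and the value
      \<open>t\<close>, so that the product law can be used.\<close>
    let ?g = "\<lambda>r t. indicat_real B (r + h t) * indicator C t"
    have g [measurable]: "case_prod ?g \<in> borel_measurable (borel \<Otimes>\<^sub>M borel)"
      by measurable
    have "(LINT \<omega>:A|M. indicator (X -` B \<inter> space M) \<omega>) = (LINT \<omega>|M. ?g (X \<omega> - h (T \<omega>)) (T \<omega>))"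
      unfolding set_lebesgue_integral_def
      by (intro Bochner_Integration.integral_cong) (auto simp: A indicator_def)
    also have "\<dots> = (LINT z|distr M borel (\<lambda>\<omega>. (X \<omega> - h (T \<omega>), T \<omega>)). case_prod ?g z)"
      by (subst integral_distr) (simp_all add: borel_prod[symmetric])
    also have "\<dots> = (LINT t|distr M borel T. LINT r|R. ?g r t)"
      unfolding distr
      by (intro RT.integral_snd[symmetric] RT.P.integrable_const_bound[where B=1])
         (auto simp: indicator_def)
    also have "\<dots> = (LINT t|distr M borel T. indicator C t *\<^sub>R ?k t)"
      by (simp add: k mult.commute)
    also have "\<dots> = (LINT \<omega>:A|M. ?k (T \<omega>))"
      unfolding set_lebesgue_integral_def
      by (subst integral_distr)
         (auto simp: A indicator_def intro!: Bochner_Integration.integral_cong)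
    finally show "(LINT \<omega>:A|M. indicator (X -` B \<inter> space M) \<omega>) = (LINT \<omega>:A|M. ?k (T \<omega>))" .
  next
    show "integrable M (indicat_real (X -` B \<inter> space M))"
      by (simp add: integrable_indicator_iff emeasure_eq_measure)
    show "integrable M (\<lambda>\<omega>. ?k (T \<omega>))"
      by (rule integrable_const_bound[where B=1])
         (auto intro!: prob_space.prob_le_1 R.prob_space_distr)
    show "(\<lambda>\<omega>. ?k (T \<omega>)) \<in> borel_measurable ?F"
      by (rule measurable_compose[OF T_F]) simp
  qed
qed simp_all

section \<open>Quadratic forms of the two covariance matrices\<close>

lemma exp_minus_half_add: "exp (- (a + b) / 2) = exp (- a / 2) * exp (- b / 2)" for a b :: real
  by (simp add: field_simps flip: exp_add)

lemma sample_mean_eq_inner: "sample_mean x = (1 \<bullet> x) / real CARD('n)" for x :: "real ^ 'n"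
  by (simp add: sample_mean_def inner_vec_def)

lemma inner_one_one: "(1 :: real ^ 'n) \<bullet> 1 = real CARD('n)"
  by (simp add: inner_vec_def)

text \<open>The matrix is \<open>(1 - r) * v\<close> times the identity plus \<open>r * v\<close>
  times the all-ones matrix, and the latter sends \<open>t\<close> to \<open>1 \<bullet> t\<close>
  times the ones vector.\<close>

lemma inner_exchangeable_cov:
  fixes t :: "real ^ 'n"
  shows "t \<bullet> (exchangeable_cov v r *v t) = (1 - r) * v * (t \<bullet> t) + r * v * (1 \<bullet> t)\<^sup>2"
proof -
  have "exchangeable_cov v r *v t = ((1 - r) * v) *\<^sub>R t + (r * v * (1 \<bullet> t)) *\<^sub>R 1"
  proof (rule vec_eq_iff[THEN iffD2, rule_format])
    fix i
    have "(exchangeable_cov v r *v t) $ i =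
        (\<Sum>j\<in>UNIV. (if i = j then (1 - r) * v * t $ j else 0) + r * v * t $ j)"
      unfolding matrix_vector_mult_def exchangeable_cov_def
      by (auto intro!: sum.cong simp: algebra_simps)
    then show "(exchangeable_cov v r *v t) $ i =
        (((1 - r) * v) *\<^sub>R t + (r * v * (1 \<bullet> t)) *\<^sub>R 1) $ i"
      by (simp add: sum.distrib inner_vec_def sum_distrib_left)
  qed
  then show ?thesis
    by (simp add: inner_add_right power2_eq_square inner_commute)
qed

lemma inner_mat: "t \<bullet> (mat c *v t) = c * (t \<bullet> t)" for t :: "real ^ 'n"
proof -
  have "mat c *v t = c *\<^sub>R t"
    by (simp add: vec_eq_iff matrix_vector_mult_def mat_def if_distrib[of "\<lambda>a. a * _"] cong: if_cong)
  then show ?thesis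
    by simp
qed

section \<open>Independence of residual and sample mean\<close>

context
  fixes M :: "'a measure" and X :: "'a \<Rightarrow> real ^ 'n" and \<phi> :: "real \<Rightarrow> complex" and c :: real
  assumes prob: "prob_space M" and X [measurable]: "X \<in> borel_measurable M"
    and cf: "\<And>t. (LINT \<omega>|M. cis (t \<bullet> X \<omega>)) = \<phi> (1 \<bullet> t) * exp (- (c * (t \<bullet> t)) / 2)"
begin

lemma measurable_sample_mean [measurable]: "(\<lambda>\<omega>. sample_mean (X \<omega>)) \<in> borel_measurable M"
  unfolding sample_mean_eq_inner by measurable

text \<open>Any combination of residual and mean is a linear functional of \<open>X\<close>. Its
  coefficient vector splits orthogonally into the centered part of \<open>t\<close> and a multiple
  of the ones vector; Pythagoras separates the quadratic term, while \<phi> sees only the coordinate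
  sum \<open>s\<close>.\<close>

lemma integral_cis_residual_mean:
  "(LINT \<omega>|M. cis (t \<bullet> (X \<omega> - sample_mean (X \<omega>) *\<^sub>R 1) + s \<bullet> sample_mean (X \<omega>))) =
    exp (- (c * (t \<bullet> t - (1 \<bullet> t)\<^sup>2 / CARD('n))) / 2) * (\<phi> s * exp (- (c * s\<^sup>2 / CARD('n)) / 2))"
proof -
  \<comment> \<open>Obtained by collecting the coefficients of \<open>X\<close>: the mean occurs
    with total weight \<open>s - 1 \<bullet> t\<close>, spread evenly over the coordinates.\<close>
  define t' where "t' = t + ((s - 1 \<bullet> t) / CARD('n)) *\<^sub>R 1"
  have "t \<bullet> (X \<omega> - sample_mean (X \<omega>) *\<^sub>R 1) + s \<bullet> sample_mean (X \<omega>) = t' \<bullet> X \<omega>" for \<omega>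
    by (simp add: t'_def sample_mean_eq_inner inner_diff_right inner_add_left inner_commute[of t 1]
        field_simps)
  moreover have "1 \<bullet> t' = s"
    by (simp add: t'_def inner_add_right inner_one_one)
  moreover have "t' \<bullet> t' = (t \<bullet> t - (1 \<bullet> t)\<^sup>2 / CARD('n)) + s\<^sup>2 / CARD('n)"
    by (simp add: t'_def inner_add_left inner_add_right inner_one_one inner_commute[of t 1]
        power2_eq_square field_simps)
  ultimately show ?thesis
    by (simp only: cf distrib_left exp_minus_half_add of_real_mult) simp
qed

lemma cf_zero: "\<phi> 0 = 1"
  using cf[of 0] prob_space.prob_space[OF prob] by simp

text \<open>At \<open>s = 0\<close> the factor \<phi> becomes 1, so only \<open>c\<close> survives
  from the law of \<open>X\<close>.\<close>

lemma integral_cis_residual: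
  "(LINT \<omega>|M. cis (t \<bullet> (X \<omega> - sample_mean (X \<omega>) *\<^sub>R 1))) =
    exp (- (c * (t \<bullet> t - (1 \<bullet> t)\<^sup>2 / CARD('n))) / 2)"
  using integral_cis_residual_mean[of t 0] by (simp add: cf_zero)

text \<open>Taking \<open>t = 0\<close> in the joint transform isolates the transform of the mean,
  and the joint transform is the product of the two.\<close>

lemma distr_residual_mean:
  "distr M borel (\<lambda>\<omega>. (X \<omega> - sample_mean (X \<omega>) *\<^sub>R 1, sample_mean (X \<omega>))) =
    distr M borel (\<lambda>\<omega>. X \<omega> - sample_mean (X \<omega>) *\<^sub>R 1) \<Otimes>\<^sub>M distr M borel (\<lambda>\<omega>. sample_mean (X \<omega>))"
proof (rule distr_Pair_eqI_cis[OF prob])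
  fix t :: "real ^ 'n" and s :: real
  have "(LINT \<omega>|M. cis (s \<bullet> sample_mean (X \<omega>))) = \<phi> s * exp (- (c * s\<^sup>2 / CARD('n)) / 2)"
    using integral_cis_residual_mean[of 0 s] by simp
  then show "(LINT \<omega>|M. cis (t \<bullet> (X \<omega> - sample_mean (X \<omega>) *\<^sub>R 1) + s \<bullet> sample_mean (X \<omega>))) =
      (LINT \<omega>|M. cis (t \<bullet> (X \<omega> - sample_mean (X \<omega>) *\<^sub>R 1))) * (LINT \<omega>|M. cis (s \<bullet> sample_mean (X \<omega>)))"
    by (simp only: integral_cis_residual integral_cis_residual_mean)
qed simp_all

end

text \<open>For nonnegative \<open>c\<close> this is the centered normal law with singular
  covariance c (I - J/n), where J is the all-ones matrix: the bracket is the squared length of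
  \<open>t\<close> projected orthogonally to the ones vector. Being a predicate, it fixes the law by
  its transform without exhibiting a measure.\<close>

definition residual_law :: "real \<Rightarrow> (real ^ 'n) measure \<Rightarrow> bool" where
  "residual_law c R \<longleftrightarrow> prob_space R \<and> sets R = sets borel \<and>
     (\<forall>t. (LINT r|R. cis (t \<bullet> r)) = exp (- (c * (t \<bullet> t - (1 \<bullet> t)\<^sup>2 / CARD('n))) / 2))"

text \<open>This allows the residual law of one vector to stand in for that of any other with the
  same \<open>c\<close>.\<close>

lemma residual_law_unique:
  assumes "residual_law c R" "residual_law c R'"
  shows "R = R'"
  using assms unfolding residual_law_def
  by (intro finite_borel_measure_eqI_cis_euclidean) (auto intro: prob_space.finite_measure)

lemma residual_law_distr:
  fixes X :: "'a \<Rightarrow> real ^ 'n" and \<phi> :: "real \<Rightarrow> complex"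
  assumes "prob_space M" and [measurable]: "X \<in> borel_measurable M"
    and "\<And>t. (LINT \<omega>|M. cis (t \<bullet> X \<omega>)) = \<phi> (1 \<bullet> t) * exp (- (c * (t \<bullet> t)) / 2)"
  shows "residual_law c (distr M borel (\<lambda>\<omega>. X \<omega> - sample_mean (X \<omega>) *\<^sub>R 1))"
  using integral_cis_residual[OF assms] measurable_sample_mean[OF assms]
  by (simp add: residual_law_def integral_distr prob_space.prob_space_distr[OF assms(1)])

lemma regular_conditional_distribution_sample_mean:
  fixes X :: "'a \<Rightarrow> real ^ 'n" and \<phi> :: "real \<Rightarrow> complex"
  assumes "residual_law c R"
    and X: "prob_space M" "X \<in> borel_measurable M"
      "\<And>t. (LINT \<omega>|M. cis (t \<bullet> X \<omega>)) = \<phi> (1 \<bullet> t) * exp (- (c * (t \<bullet> t)) / 2)"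
  shows "regular_conditional_distribution M X (\<lambda>\<omega>. sample_mean (X \<omega>))
    (\<lambda>x. distr R borel (\<lambda>r. r + x *\<^sub>R 1))"
proof (rule regular_conditional_distribution_shift)
  show "distr M borel (\<lambda>\<omega>. (X \<omega> - sample_mean (X \<omega>) *\<^sub>R 1, sample_mean (X \<omega>))) =
      R \<Otimes>\<^sub>M distr M borel (\<lambda>\<omega>. sample_mean (X \<omega>))"
    using distr_residual_mean[OF X] residual_law_unique[OF residual_law_distr[OF X] assms(1)] by simp
qed (use assms measurable_sample_mean[OF X] in \<open>simp_all add: residual_law_def\<close>)

section \<open>A common kernel for both vectors\<close>

theorem lemma2p2:
  fixes \<sigma> \<rho> :: real
  assumes "\<sigma>\<^sup>2 > 0" and "\<rho> \<in> {-1..1}"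
    and "positive_semidefinite (exchangeable_cov (\<sigma>\<^sup>2) \<rho> :: real ^ 'n ^ 'n)"
  shows "\<exists>\<kappa> \<in> (borel :: real measure) \<rightarrow>\<^sub>M prob_algebra (borel :: (real ^ 'n) measure).
    \<forall>\<mu> :: real.
      (\<forall>(M :: 'a measure) X.
         prob_space M \<longrightarrow>
         multivariate_normal M X (\<chi> i. \<mu>) (exchangeable_cov (\<sigma>\<^sup>2) \<rho>) \<longrightarrow>
         regular_conditional_distribution M X (\<lambda>\<omega>. sample_mean (X \<omega>)) \<kappa>) \<and>
      (\<forall>(N :: 'b measure) Y.
         prob_space N \<longrightarrow>
         multivariate_normal N Y (\<chi> i. \<mu>) (mat ((1 - \<rho>) * \<sigma>\<^sup>2)) \<longrightarrow>
         regular_conditional_distribution N Y (\<lambda>\<omega>. sample_mean (Y \<omega>)) \<kappa>)"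
proof -
  define c where "c = (1 - \<rho>) * \<sigma>\<^sup>2"
  have mean: "t \<bullet> (\<chi> i. \<mu>) = \<mu> * (1 \<bullet> t)" for t :: "real ^ 'n" and \<mu>
    by (simp add: inner_vec_def sum_distrib_left mult.commute)
  \<comment> \<open>Here \<phi> absorbs \<mu> and the all-ones part of the covariance. For negative
    \<rho> it is unbounded and so no characteristic function, but only the factorized form
    matters.\<close>
  have cf_X: "(LINT \<omega>|M. cis (t \<bullet> X \<omega>)) =
      (\<lambda>s. cis (\<mu> * s) * exp (- (\<rho> * \<sigma>\<^sup>2 * s\<^sup>2) / 2)) (1 \<bullet> t) * exp (- (c * (t \<bullet> t)) / 2)"
    if "multivariate_normal M X (\<chi> i. \<mu>) (exchangeable_cov (\<sigma>\<^sup>2) \<rho>)"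
    for M :: "'a measure" and X :: "'a \<Rightarrow> real ^ 'n" and \<mu> t
    unfolding multivariate_normal_integral_cis[OF that] mean inner_exchangeable_cov
    by (simp only: exp_minus_half_add of_real_mult c_def) simp
  \<comment> \<open>The covariance of \<open>Y\<close> has no all-ones part, so \<phi> carries \<mu>
    alone; the constant \<open>c\<close> is the same as for \<open>X\<close>.\<close>
  have cf_Y: "(LINT \<omega>|N. cis (t \<bullet> Y \<omega>)) = (\<lambda>s. cis (\<mu> * s)) (1 \<bullet> t) * exp (- (c * (t \<bullet> t)) / 2)"
    if "multivariate_normal N Y (\<chi> i. \<mu>) (mat ((1 - \<rho>) * \<sigma>\<^sup>2))"
    for N :: "'b measure" and Y :: "'b \<Rightarrow> real ^ 'n" and \<mu> t
    unfolding multivariate_normal_integral_cis[OF that] mean inner_mat c_def ..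
  \<comment> \<open>Without any vector of either kind the kernel is arbitrary; otherwise the law of its residual
    serves for all of them, so no Gaussian measure on \<open>\<real>\<^sup>n\<close> has to be constructed.\<close>
  obtain R :: "(real ^ 'n) measure" where R: "prob_space R" "sets R = sets borel"
    and law: "residual_law c R' \<Longrightarrow> residual_law c R"
    for R' :: "(real ^ 'n) measure"
  proof (cases "\<exists>R :: (real ^ 'n) measure. residual_law c R")
    case True
    then show ?thesis
      using that by (auto simp: residual_law_def)
  next
    case False
    then show ?thesis
      by (intro that[of "return borel 0"]) (auto simp: prob_space_return)
  qed
  show ?thesis
  proof (intro bexI allI conjI impI)
    show "(\<lambda>x. distr R borel (\<lambda>r. r + x *\<^sub>R 1)) \<in> borel \<rightarrow>\<^sub>M prob_algebra borel"
      using R by (intro measurable_distr_shift) simp_all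
  next
    fix \<mu> and M :: "'a measure" and X :: "'a \<Rightarrow> real ^ 'n"
    assume M: "prob_space M" and X: "multivariate_normal M X (\<chi> i. \<mu>) (exchangeable_cov (\<sigma>\<^sup>2) \<rho>)"
    then have meas: "X \<in> borel_measurable M"
      by (simp add: multivariate_normal_def)
    note cf = M meas cf_X[OF X]
    show "regular_conditional_distribution M X (\<lambda>\<omega>. sample_mean (X \<omega>))
        (\<lambda>x. distr R borel (\<lambda>r. r + x *\<^sub>R 1))"
      using cf by (rule regular_conditional_distribution_sample_mean[OF law[OF residual_law_distr[OF cf]]])
  next
    fix \<mu> and N :: "'b measure" and Y :: "'b \<Rightarrow> real ^ 'n"
    assume N: "prob_space N" and Y: "multivariate_normal N Y (\<chi> i. \<mu>) (mat ((1 - \<rho>) * \<sigma>\<^sup>2))"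
    then have meas: "Y \<in> borel_measurable N"
      by (simp add: multivariate_normal_def)
    note cf = N meas cf_Y[OF Y]
    show "regular_conditional_distribution N Y (\<lambda>\<omega>. sample_mean (Y \<omega>))
        (\<lambda>x. distr R borel (\<lambda>r. r + x *\<^sub>R 1))"
      using cf by (rule regular_conditional_distribution_sample_mean[OF law[OF residual_law_distr[OF cf]]])
  qed
qed

end
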